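(* Consider the problem $\min_{\mathbf{x}\in\mathcal{X}}\max_{|S|\le k}f(\mathbf{x},S)$, where $\mathcal{X}\subset\mathbb{R}^d$ is convex and bounded, and $f:\mathbb{R}^d\times2^V\to\mathbb{R}_+$ is convex in $\mathbf{x}$ and monotone submodular in $S$. Suppose that: (1) there is $L$ such that $\|\nabla_{\mathbf{x}}f(\mathbf{x},S)-\nabla_{\mathbf{x}}f(\mathbf{x}',S)\|\le L\|\mathbf{x}-\mathbf{x}'\|$ for all $\mathbf{x},\mathbf{x}'\in\mathbb{R}^d$ and all $S$ with $|S|\le k$; (2) there is $M$ such that $\|\nabla_{\mathbf{x}}f(\mathbf{x},S)\|\le M$ for all $\mathbf{x}\in\mathbb{R}^d$ and $S\in2^V$. Then the output $\mathbf{x}_{sol}$ of the Gradient Replacement-Greedy (GRG) algorithm after $\mathcal{O}(1/\epsilon^2)$ iterations with step size $\mathcal{O}(\epsilon)$ is a $(1/2,\epsilon)$-approximate minimax solution, i.e. $$\tfrac12\max_{|S|\le k}f(\mathbf{x}_{sol},S)\le \min_{\mathbf{x}\in\mathcal{X}}\max_{|S|\le k}f(\mathbf{x},S)+\epsilon .$$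
   Context: $V$ is a finite ground set with $n$ elements and $k\le n$ is a positive integer. A set function $g:2^V\to\mathbb{R}$ is submodular if $g(A\cap B)+g(A\cup B)\le g(A)+g(B)$ for all $A,B\subseteq V$, and monotone if $g(A)\le g(B)$ whenever $A\subseteq B$. $\pi_{\mathcal{X}}$ denotes Euclidean projection onto $\mathcal{X}$ (assumed well defined), and $\nabla f(\mathbf{x},S)=\nabla_{\mathbf{x}}f(\mathbf{x},S)$. Replacement greedy subroutine $\textsc{RepGreedy}(f,k,\mathbf{x},S)$: let $\Delta_ef(\mathbf{x},S)=f(\mathbf{x},S\cup\{e\})-f(\mathbf{x},S)$. If $|S|<k$, return $S^+=S\cup\{\arg\max_{e\in V}\Delta_ef(\mathbf{x},S)\}$. If $|S|=k$, let $e^*=\arg\max_{e\in S}f(\mathbf{x},S\setminus\{e\})$ and return $S^+=(S\setminus\{e^*\})\cup\{\arg\max_{e\in V}\Delta_ef(\mathbf{x},S\setminus\{e^*\})\}$. Gradient Replacement-Greedy (GRG): initialize $S_1=\emptyset$, $\mathbf{x}_1=\mathbf{0}$. For $t=1,\dots,T$: $\mathbf{x}_{t+1}=\pi_{\mathcal{X}}(\mathbf{x}_t-\gamma_t\nabla f(\mathbf{x}_t,S_t))$ and $S_{t+1}=\textsc{RepGreedy}(f,k,\mathbf{x}_{t+1},S_t)$, where $\gamma_t>0$ are step sizes. Output $\mathbf{x}_{sol}=\big(\sum_{t=1}^T\gamma_t\big)^{-1}\sum_{t=1}^T\gamma_t\mathbf{x}_t$. Meaning of the asymptotic statement: there are constants,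 independent of $\epsilon$ (they may depend on $f,\mathcal{X},k$ and the constants in the hypotheses), such that for all sufficiently small $\epsilon>0$ the conclusion holds for a suitable number of iterations $T$ that is at most a constant times $1/\epsilon^2$ and suitable step sizes at most a constant times $\epsilon$. *)

theory Defs
  imports "HOL-Analysis.Analysis"
begin

text \<open>A set function on the subsets of a ground set \<open>V\<close> is a function on \<open>'v set\<close> of which only
  the values on \<open>Pow V\<close> matter. A function \<open>f(x, S)\<close> is written curried, \<open>f x S\<close>.\<close>

definition submodular_on :: "'v set \<Rightarrow> ('v set \<Rightarrow> real) \<Rightarrow> bool" where
  "submodular_on V g \<longleftrightarrow>
     (\<forall>A B. A \<subseteq> V \<longrightarrow> B \<subseteq> V \<longrightarrow> g (A \<inter> B) + g (A \<union> B) \<le> g A + g B)"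

text \<open>The gradient in the first argument. It is meaningful only where \<open>\<lambda>y. f y S\<close> is
  differentiable at \<open>x\<close>; there the vector \<open>D\<close> is unique.\<close>

definition grad :: "('a::euclidean_space \<Rightarrow> 'v set \<Rightarrow> real) \<Rightarrow> 'a \<Rightarrow> 'v set \<Rightarrow> 'a" where
  "grad f x S = (THE D. GDERIV (\<lambda>y. f y S) x :> D)"

text \<open>Every point has exactly one nearest point in \<open>X\<close>, which is then \<open>closest_point X y\<close>. In
  particular \<open>X\<close> is nonempty and closed.\<close>

definition projection_well_defined :: "'a::euclidean_space set \<Rightarrow> bool" where
  "projection_well_defined X \<longleftrightarrow> (\<forall>y. \<exists>!p. p \<in> X \<and> (\<forall>q\<in>X. dist y p \<le> dist y q))"

definition marginal_gain :: "('a \<Rightarrow> 'v set \<Rightarrow> real) \<Rightarrow> 'a \<Rightarrow> 'v set \<Rightarrow> 'v \<Rightarrow> real" where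
  "marginal_gain f x S e = f x (S \<union> {e}) - f x S"

text \<open>The subroutine is a relation between input \<open>S\<close> and output \<open>S'\<close>, so that ties in the
  maximisations may be broken in any way.\<close>

definition rep_greedy ::
  "'v set \<Rightarrow> ('a \<Rightarrow> 'v set \<Rightarrow> real) \<Rightarrow> nat \<Rightarrow> 'a \<Rightarrow> 'v set \<Rightarrow> 'v set \<Rightarrow> bool" where
  "rep_greedy V f k x S S' \<longleftrightarrow>
     (card S < k \<and>
       (\<exists>e. is_arg_max (marginal_gain f x S) (\<lambda>e. e \<in> V) e \<and> S' = S \<union> {e})) \<or>
     (card S = k \<and>
       (\<exists>e0 e. is_arg_max (\<lambda>e. f x (S - {e})) (\<lambda>e. e \<in> S) e0 \<and>
               is_arg_max (marginal_gain f x (S - {e0})) (\<lambda>e. e \<in> V) e \<and>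
               S' = (S - {e0}) \<union> {e}))"

text \<open>The iterates are indexed from \<open>1\<close>; the starting point \<open>0\<close> need not belong to \<open>X\<close>.\<close>

definition grg_run ::
  "'v set \<Rightarrow> 'a::euclidean_space set \<Rightarrow> ('a \<Rightarrow> 'v set \<Rightarrow> real) \<Rightarrow> nat \<Rightarrow> nat \<Rightarrow> (nat \<Rightarrow> real)
     \<Rightarrow> (nat \<Rightarrow> 'a) \<Rightarrow> (nat \<Rightarrow> 'v set) \<Rightarrow> bool" where
  "grg_run V X f k T \<gamma> x S \<longleftrightarrow>
     x 1 = 0 \<and> S 1 = {} \<and>
     (\<forall>t\<in>{1..T}.
        x (t + 1) = closest_point X (x t - \<gamma> t *\<^sub>R grad f (x t) (S t)) \<and>
        rep_greedy V f k (x (t + 1)) (S t) (S (t + 1)))"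

definition grg_output :: "nat \<Rightarrow> (nat \<Rightarrow> real) \<Rightarrow> (nat \<Rightarrow> 'a::euclidean_space) \<Rightarrow> 'a" where
  "grg_output T \<gamma> x = inverse (\<Sum>t=1..T. \<gamma> t) *\<^sub>R (\<Sum>t=1..T. \<gamma> t *\<^sub>R x t)"

definition max_value :: "'v set \<Rightarrow> nat \<Rightarrow> ('a \<Rightarrow> 'v set \<Rightarrow> real) \<Rightarrow> 'a \<Rightarrow> real" where
  "max_value V k f x = Max {f x S |S. S \<subseteq> V \<and> card S \<le> k}"

text \<open>The infimum is a minimum when \<open>X\<close> is nonempty and compact and \<open>f\<close> is continuous in its
  first argument.\<close>

definition approx_minimax_solution ::
  "'v set \<Rightarrow> 'a set \<Rightarrow> nat \<Rightarrow> ('a \<Rightarrow> 'v set \<Rightarrow> real) \<Rightarrow> real \<Rightarrow> real \<Rightarrow> 'a \<Rightarrow> bool" where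
  "approx_minimax_solution V X k f \<alpha> \<epsilon> x \<longleftrightarrow>
     \<alpha> * max_value V k f x \<le> (INF y\<in>X. max_value V k f y) + \<epsilon>"

end

theory Submission
  imports Defs
begin

text \<open>
  Write \<open>F x\<close> for \<open>max_value V k f x\<close> and let the \<^emph>\<open>gap\<close> of \<open>(x, S)\<close> be \<open>F x / 2 - f x S\<close>.

  For fixed \<open>x\<close>, submodularity makes one replacement step cheap to analyse: dropping the least
  useful of \<open>k\<close> elements keeps at least the fraction \<open>1 - 1/k\<close> of the value, and adding the best
  element closes at least the fraction \<open>1/k\<close> of the distance to \<open>F x\<close>. Together the new set has value
  at least \<open>(1 - 1/k)\<^sup>2 f x S + F x / k\<close>, so the positive part of the gap shrinks by the factor
  \<open>1 - 1/k\<close> (\<open>rep_greedy_gap\<close>). Moving \<open>x\<close> between two such steps changes the gap by at most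
  \<open>3/2 M\<close> times the length of the move, because \<open>f\<close> and \<open>F\<close> are \<open>M\<close>-Lipschitz in \<open>x\<close>. All moves
  but the first one, which jumps from \<open>0\<close> into \<open>X\<close>, have length at most \<open>\<gamma> M\<close>; summing the
  contraction over \<open>t\<close>, the average gap over \<open>T\<close> rounds is \<open>O(1/T + \<gamma>)\<close>.

  Independently of how the sets \<open>S t\<close> are produced, projected subgradient descent has small regret
  (\<open>projected_gradient_regret\<close>): the average of \<open>f (x t) (S t)\<close> exceeds the average of
  \<open>f y (S t)\<close>, hence \<open>F y\<close>, by at most \<open>O(1/(\<gamma> T) + \<gamma>)\<close> for every \<open>y \<in> X\<close>. Since \<open>F\<close> is convex,
  half its value at the averaged iterate is at most the average of \<open>F (x t) / 2\<close>, which is the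
  average of \<open>f (x t) (S t)\<close> plus the average gap. The choice \<open>\<gamma> \<approx> \<epsilon>\<close>, \<open>T \<approx> 1/\<epsilon>\<^sup>2\<close> makes all
  error terms together at most \<open>\<epsilon>\<close>.
\<close>

section \<open>Monotone submodular functions and the greedy steps\<close>

lemma submodular_onD:
  "submodular_on V g \<Longrightarrow> A \<subseteq> V \<Longrightarrow> B \<subseteq> V \<Longrightarrow> g (A \<inter> B) + g (A \<union> B) \<le> g A + g B"
  by (simp add: submodular_on_def)

text \<open>The marginal gains over \<open>A\<close> of the elements of \<open>B\<close>, taken one at a time, bound the joint
  gain of \<open>B\<close>.\<close>

lemma submodular_on_union_le:
  assumes "submodular_on V g" "A \<subseteq> V" "finite B" "B \<subseteq> V"
  shows "g (A \<union> B) - g A \<le> (\<Sum>e\<in>B. g (A \<union> {e}) - g A)"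
  using assms(3,4)
proof (induction B rule: finite_induct)
  case empty
  then show ?case by simp
next
  case (insert b B)
  have "g ((A \<union> {b}) \<inter> (A \<union> B)) + g ((A \<union> {b}) \<union> (A \<union> B)) \<le> g (A \<union> {b}) + g (A \<union> B)"
    by (rule submodular_onD[OF assms(1)]) (use assms(2) insert.prems in auto)
  moreover have "(A \<union> {b}) \<inter> (A \<union> B) = A" "(A \<union> {b}) \<union> (A \<union> B) = A \<union> insert b B"
    using insert.hyps by auto
  ultimately show ?case
    using insert by simp
qed

lemma submodular_on_sum_removals_le:
  assumes "submodular_on V g" "A \<subseteq> V" "finite B" "B \<subseteq> A"
  shows "(\<Sum>e\<in>B. g A - g (A - {e})) \<le> g A - g (A - B)"
  using assms(3,4)
proof (induction B rule: finite_induct)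
  case empty
  then show ?case by simp
next
  case (insert b B)
  have "g ((A - {b}) \<inter> (A - B)) + g ((A - {b}) \<union> (A - B)) \<le> g (A - {b}) + g (A - B)"
    by (rule submodular_onD[OF assms(1)]) (use assms(2) in auto)
  moreover have "(A - {b}) \<inter> (A - B) = A - insert b B" "(A - {b}) \<union> (A - B) = A"
    using insert.hyps insert.prems by auto
  ultimately show ?case
    using insert by simp
qed

text \<open>The greedy element closes at least the fraction \<open>1/k\<close> of the distance from \<open>g A\<close> to the value of
  any competitor \<open>B\<close> with at most \<open>k\<close> elements.\<close>

lemma greedy_addition_ge:
  assumes "finite V" "submodular_on V g" "mono_on (Pow V) g"
    and "A \<subseteq> V" "B \<subseteq> V" "card B \<le> k" "0 < k"
    and e: "is_arg_max (\<lambda>e. g (A \<union> {e}) - g A) (\<lambda>e. e \<in> V) e"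
  shows "(1 - 1 / real k) * g A + g B / real k \<le> g (A \<union> {e})"
proof -
  let ?m = "g (A \<union> {e}) - g A"
  have eV: "e \<in> V" and best: "\<And>b. b \<in> V \<Longrightarrow> g (A \<union> {b}) - g A \<le> ?m"
    using e by (auto simp: is_arg_max_linorder)
  have "finite B"
    using assms finite_subset by blast
  have "0 \<le> ?m"
    using assms(3,4) eV by (auto intro: mono_onD)
  have "g B \<le> g (A \<union> B)"
    using assms(3-5) by (auto intro: mono_onD)
  also have "\<dots> \<le> g A + (\<Sum>b\<in>B. g (A \<union> {b}) - g A)"
    using submodular_on_union_le[OF assms(2,4) \<open>finite B\<close> assms(5)] by simp
  also have "\<dots> \<le> g A + (\<Sum>b\<in>B. ?m)"
    using best assms(5) by (intro add_left_mono sum_mono) auto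
  also have "\<dots> = g A + real (card B) * ?m"
    by simp
  also have "\<dots> \<le> g A + real k * ?m"
    using \<open>0 \<le> ?m\<close> \<open>card B \<le> k\<close> by (intro add_left_mono mult_right_mono) auto
  finally show ?thesis
    using \<open>0 < k\<close> by (simp add: field_simps)
qed

lemma greedy_removal_ge:
  assumes "submodular_on V g" "A \<subseteq> V" "card A = k" "0 < k" "0 \<le> g {}"
    and e: "is_arg_max (\<lambda>e. g (A - {e})) (\<lambda>e. e \<in> A) e"
  shows "(1 - 1 / real k) * g A \<le> g (A - {e})"
proof -
  have "finite A"
    using assms(3,4) card_ge_0_finite by blast
  have "real k * (g A - g (A - {e})) = (\<Sum>b\<in>A. g A - g (A - {e}))"
    using assms(3) by simp
  also have "\<dots> \<le> (\<Sum>b\<in>A. g A - g (A - {b}))"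
    using e by (intro sum_mono) (auto simp: is_arg_max_linorder)
  also have "\<dots> \<le> g A - g (A - A)"
    by (rule submodular_on_sum_removals_le[OF assms(1,2) \<open>finite A\<close>]) simp
  also have "\<dots> \<le> g A"
    using assms(5) by simp
  finally show ?thesis
    using \<open>0 < k\<close> by (simp add: field_simps)
qed

lemma rep_greedy_feasible:
  assumes "finite V" "rep_greedy V f k x S S'" "S \<subseteq> V" "card S \<le> k" "0 < k"
  shows "S' \<subseteq> V" "card S' \<le> k"
proof -
  have fin: "finite S"
    using assms(1,3) finite_subset by blast
  have "card (S \<union> {e}) \<le> k" if "card S < k" for e
    using that fin by (simp add: card_insert_if)
  moreover have "card ((S - {e0}) \<union> {e}) \<le> k" if "e0 \<in> S" for e0 e
  proof -
    have "card (insert e (S - {e0})) \<le> Suc (card (S - {e0}))"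
      by (rule card_insert_le_m1) auto
    also have "\<dots> = card S"
      using card_Suc_Diff1[OF fin that] .
    finally show ?thesis
      using assms(4) by simp
  qed
  ultimately show "S' \<subseteq> V" "card S' \<le> k"
    using assms(2,3) by (auto simp: rep_greedy_def is_arg_max_linorder)
qed

section \<open>The maximum over the feasible sets\<close>

lemma finite_feasible_values: "finite V \<Longrightarrow> finite {f x S |S. S \<subseteq> V \<and> card S \<le> k}"
  by (rule finite_subset[of _ "f x ` Pow V"]) auto

lemma max_value_ge:
  assumes "finite V" "S \<subseteq> V" "card S \<le> k"
  shows "f x S \<le> max_value V k f x"
  unfolding max_value_def using assms by (intro Max_ge finite_feasible_values) auto

lemma max_value_attained:
  assumes "finite V"
  obtains S where "S \<subseteq> V" "card S \<le> k" "max_value V k f x = f x S"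
proof -
  have "max_value V k f x \<in> {f x S |S. S \<subseteq> V \<and> card S \<le> k}"
    unfolding max_value_def
    by (intro Max_in finite_feasible_values assms) (auto intro!: exI[of _ "{}"])
  then show thesis
    using that by blast
qed

lemma rep_greedy_gap:
  assumes "finite V" "submodular_on V (f x)" "mono_on (Pow V) (f x)"
    and nonneg: "\<And>S. S \<subseteq> V \<Longrightarrow> 0 \<le> f x S"
    and "S \<subseteq> V" "0 < k" and rep: "rep_greedy V f k x S S'"
  shows "max_value V k f x / 2 - f x S' \<le> (1 - 1 / real k) * max 0 (max_value V k f x / 2 - f x S)"
proof -
  define q where "q = 1 - 1 / real k"
  have q: "0 \<le> q" "q \<le> 1"
    using \<open>0 < k\<close> by (auto simp: q_def)
  obtain B where B: "B \<subseteq> V" "card B \<le> k" "max_value V k f x = f x B"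
    using max_value_attained[OF assms(1)] by metis
  have add: "q * f x A + f x B / real k \<le> f x (A \<union> {e})"
    if "A \<subseteq> V" "is_arg_max (marginal_gain f x A) (\<lambda>e. e \<in> V) e" for A e
    using greedy_addition_ge[of V "f x" A B k e] assms B that
    by (simp add: q_def marginal_gain_def[abs_def])
  have "q * (q * f x S) + f x B / real k \<le> f x S'"
    using rep unfolding rep_greedy_def
  proof (elim disjE conjE exE)
    fix e assume "is_arg_max (marginal_gain f x S) (\<lambda>e. e \<in> V) e" and S': "S' = S \<union> {e}"
    moreover have "q * (q * f x S) \<le> q * f x S"
      using q nonneg[OF \<open>S \<subseteq> V\<close>] by (intro mult_left_mono mult_left_le_one_le) auto
    ultimately show ?thesis
      using add[OF \<open>S \<subseteq> V\<close>, of e] by simp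
  next
    fix e0 e
    assume "card S = k" and e0: "is_arg_max (\<lambda>e. f x (S - {e})) (\<lambda>e. e \<in> S) e0"
      and e: "is_arg_max (marginal_gain f x (S - {e0})) (\<lambda>e. e \<in> V) e"
      and S': "S' = (S - {e0}) \<union> {e}"
    have "q * f x S \<le> f x (S - {e0})"
      unfolding q_def using greedy_removal_ge[OF assms(2,5) \<open>card S = k\<close> \<open>0 < k\<close> _ e0] nonneg by simp
    then have "q * (q * f x S) \<le> q * f x (S - {e0})"
      using q by (intro mult_left_mono)
    moreover have "S - {e0} \<subseteq> V"
      using \<open>S \<subseteq> V\<close> by auto
    ultimately show ?thesis
      unfolding S' using add[OF _ e] by linarith
  qed
  \<comment> \<open>Since \<open>1/k = 1 - q\<close>, the coefficient of \<open>f x B\<close> is \<open>1/2 - 1/k = q\<^sup>2/2 - (1 - q)\<^sup>2/2\<close>.\<close>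
  moreover have "f x B / real k = (1 - q) * f x B"
    by (simp add: q_def)
  moreover have "0 \<le> (1 - q)\<^sup>2 * f x B"
    using nonneg[OF B(1)] by simp
  ultimately have "f x B / 2 - f x S' \<le> q * (q * (f x B / 2 - f x S))"
    by (simp add: power2_eq_square algebra_simps)
  also have "\<dots> \<le> q * (q * max 0 (f x B / 2 - f x S))"
    using q by (intro mult_left_mono) auto
  also have "\<dots> \<le> q * max 0 (f x B / 2 - f x S)"
    using q by (intro mult_left_mono mult_left_le_one_le) auto
  finally show ?thesis
    by (simp add: q_def B(3))
qed

lemma max_value_lipschitz:
  assumes "finite V"
    and lip: "\<And>S. S \<subseteq> V \<Longrightarrow> f x S - f y S \<le> c"
  shows "max_value V k f x - max_value V k f y \<le> c"
proof -
  obtain S where "S \<subseteq> V" "card S \<le> k" "max_value V k f x = f x S"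
    using max_value_attained[OF assms(1)] by metis
  then show ?thesis
    using max_value_ge[OF assms(1), of S k f y] lip[of S] by simp
qed

lemma convex_on_max_value:
  assumes "finite V"
    and "\<And>S. S \<subseteq> V \<Longrightarrow> convex_on C (\<lambda>x. f x S)" and "convex C"
  shows "convex_on C (max_value V k f)"
proof (rule convex_onI)
  fix t x y assume t: "0 < t" "t < (1::real)" and xy: "x \<in> C" "y \<in> C"
  let ?z = "(1 - t) *\<^sub>R x + t *\<^sub>R y"
  obtain S where S: "S \<subseteq> V" "card S \<le> k" "max_value V k f ?z = f ?z S"
    using max_value_attained[OF assms(1)] by metis
  have "f ?z S \<le> (1 - t) * f x S + t * f y S"
    using convex_onD[OF assms(2)[OF S(1)], of t x y] t xy by simp
  also have "\<dots> \<le> (1 - t) * max_value V k f x + t * max_value V k f y"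
    using t S max_value_ge[OF assms(1) S(1,2)] by (intro add_mono mult_left_mono) auto
  finally show "max_value V k f ?z \<le> (1 - t) * max_value V k f x + t * max_value V k f y"
    using S(3) by simp
qed (use assms in auto)

section \<open>Gradients of convex functions and projection\<close>

lemma GDERIV_grad:
  assumes "(\<lambda>y. f y S) differentiable (at x)"
  shows "GDERIV (\<lambda>y. f y S) x :> grad f x S"
proof -
  obtain D where D: "((\<lambda>y. f y S) has_derivative D) (at x)"
    using assms by (auto simp: differentiable_def)
  have "linear D"
    using D has_derivative_linear by blast
  then have "D = (\<lambda>h. inner h (adjoint D 1))"
    by (simp add: adjoint_works)
  then have exists: "GDERIV (\<lambda>y. f y S) x :> adjoint D 1"
    using D by (simp add: gderiv_def)
  have unique: "E = E'" if "GDERIV (\<lambda>y. f y S) x :> E" "GDERIV (\<lambda>y. f y S) x :> E'" for E E'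
  proof -
    have "(\<lambda>h. inner h E) = (\<lambda>h. inner h E')"
      using that unfolding gderiv_def by (rule has_derivative_unique)
    then show ?thesis
      by (metis vector_eq_ldot)
  qed
  show ?thesis
    unfolding grad_def
    by (rule theI[where P = "\<lambda>D. GDERIV (\<lambda>y. f y S) x :> D", OF exists unique[OF _ exists]])
qed

lemma convex_on_grad_ineq:
  fixes f :: "'a::euclidean_space \<Rightarrow> 'v set \<Rightarrow> real"
  assumes "convex_on UNIV (\<lambda>y. f y S)" "(\<lambda>y. f y S) differentiable (at x)"
  shows "f x S - f y S \<le> inner (x - y) (grad f x S)"
proof -
  \<comment> \<open>The claim is the one-dimensional tangent inequality on the line through \<open>x\<close> and \<open>y\<close>.\<close>
  define g where "g = (\<lambda>t::real. f (x + t *\<^sub>R (y - x)) S)"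
  have "convex_on UNIV g"
  proof (rule convex_onI)
    fix t a b :: real assume t: "0 < t" "t < 1"
    have *: "x + ((1 - t) *\<^sub>R a + t *\<^sub>R b) *\<^sub>R (y - x)
       = (1 - t) *\<^sub>R (x + a *\<^sub>R (y - x)) + t *\<^sub>R (x + b *\<^sub>R (y - x))"
      by (simp add: algebra_simps)
    show "g ((1 - t) *\<^sub>R a + t *\<^sub>R b) \<le> (1 - t) * g a + t * g b"
      unfolding g_def * using t by (intro convex_onD[OF assms(1)]) auto
  qed auto
  moreover have "(g has_field_derivative inner (y - x) (grad f x S)) (at 0)"
  proof -
    have "((\<lambda>y. f y S) has_derivative (\<lambda>h. inner h (grad f x S))) (at (x + 0 *\<^sub>R (y - x)))"
      using GDERIV_grad[where f = f and S = S, OF assms(2)] by (simp add: gderiv_def)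
    moreover have "((\<lambda>t::real. x + t *\<^sub>R (y - x)) has_derivative (\<lambda>t. t *\<^sub>R (y - x))) (at 0)"
      by (auto intro!: derivative_eq_intros)
    ultimately have "(g has_derivative (\<lambda>t. inner (t *\<^sub>R (y - x)) (grad f x S))) (at 0)"
      unfolding g_def by (rule has_derivative_compose[rotated])
    then show ?thesis
      by (simp add: has_field_derivative_def mult_commute_abs)
  qed
  ultimately have "g 1 - g 0 \<ge> inner (y - x) (grad f x S) * (1 - 0)"
    by (intro convex_on_imp_above_tangent[of UNIV]) auto
  then show ?thesis
    by (simp add: g_def inner_diff_left)
qed

lemma convex_on_bounded_grad_lipschitz:
  fixes f :: "'a::euclidean_space \<Rightarrow> 'v set \<Rightarrow> real"
  assumes "convex_on UNIV (\<lambda>y. f y S)" "(\<lambda>y. f y S) differentiable (at x)"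
    and "norm (grad f x S) \<le> M"
  shows "f x S - f y S \<le> M * norm (x - y)"
proof -
  have "f x S - f y S \<le> inner (x - y) (grad f x S)"
    using assms by (intro convex_on_grad_ineq)
  also have "\<dots> \<le> norm (x - y) * norm (grad f x S)"
    by (rule norm_cauchy_schwarz)
  also have "\<dots> \<le> norm (x - y) * M"
    using assms(3) by (intro mult_left_mono) auto
  finally show ?thesis
    by (simp add: mult.commute)
qed

lemma projection_well_defined_imp_closed:
  assumes "projection_well_defined X"
  shows "closed X" "X \<noteq> {}"
proof -
  show "X \<noteq> {}"
    using assms unfolding projection_well_defined_def by blast
  have "y \<in> X" if "y \<in> closure X" for y
  proof -
    obtain p where p: "p \<in> X" "\<forall>q\<in>X. dist y p \<le> dist y q"
      using assms unfolding projection_well_defined_def by blast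
    have "dist y p \<le> 0 + e" if "0 < e" for e
      using \<open>y \<in> closure X\<close> that p(2) unfolding closure_approachable
      by (metis add_0 dist_commute less_eq_real_def order_trans)
    then have "dist y p \<le> 0"
      by (rule field_le_epsilon)
    then show ?thesis
      using p(1) by simp
  qed
  then show "closed X"
    by (metis closure_subset_eq subsetI)
qed

text \<open>The starting point \<open>x 1\<close> may lie outside \<open>X\<close>: only the comparison point \<open>y\<close> has to be fixed by
  the projection.\<close>

lemma projected_gradient_regret:
  fixes X :: "'a::euclidean_space set" and l :: "nat \<Rightarrow> 'a \<Rightarrow> real"
  assumes "convex X" "closed X" "y \<in> X"
    and step: "\<And>t. t \<in> {1..T} \<Longrightarrow> x (t + 1) = closest_point X (x t - \<gamma> t *\<^sub>R G t)"
    and pos: "\<And>t. t \<in> {1..T} \<Longrightarrow> 0 \<le> \<gamma> t"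
    and sub: "\<And>t. t \<in> {1..T} \<Longrightarrow> l t (x t) - l t y \<le> inner (x t - y) (G t)"
    and bound: "\<And>t. t \<in> {1..T} \<Longrightarrow> norm (G t) \<le> M"
  shows "(\<Sum>t=1..T. \<gamma> t * (l t (x t) - l t y)) \<le> (norm (x 1 - y))\<^sup>2 / 2 + M\<^sup>2 / 2 * (\<Sum>t=1..T. (\<gamma> t)\<^sup>2)"
proof -
  have one: "\<gamma> t * (l t (x t) - l t y)
      \<le> (norm (x t - y))\<^sup>2 / 2 - (norm (x (t + 1) - y))\<^sup>2 / 2 + M\<^sup>2 / 2 * (\<gamma> t)\<^sup>2"
    if t: "t \<in> {1..T}" for t
  proof -
    have "norm (x (t + 1) - y) \<le> norm (x t - \<gamma> t *\<^sub>R G t - y)"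
      unfolding step[OF t]
      using closest_point_lipschitz[OF assms(1,2), of "x t - \<gamma> t *\<^sub>R G t" y] assms(3)
      by (auto simp: dist_norm closest_point_self)
    then have "(norm (x (t + 1) - y))\<^sup>2 \<le> (norm ((x t - y) - \<gamma> t *\<^sub>R G t))\<^sup>2"
      by (intro power_mono) (auto simp: algebra_simps)
    also have "\<dots> = (norm (x t - y))\<^sup>2 - 2 * (\<gamma> t * inner (x t - y) (G t)) + (\<gamma> t)\<^sup>2 * (norm (G t))\<^sup>2"
      by (simp only: power2_norm_eq_inner)
        (simp add: inner_diff_left inner_diff_right inner_commute power2_eq_square algebra_simps)
    finally have "\<gamma> t * inner (x t - y) (G t)
        \<le> (norm (x t - y))\<^sup>2 / 2 - (norm (x (t + 1) - y))\<^sup>2 / 2 + (norm (G t))\<^sup>2 / 2 * (\<gamma> t)\<^sup>2"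
      by (simp add: algebra_simps)
    moreover have "\<gamma> t * (l t (x t) - l t y) \<le> \<gamma> t * inner (x t - y) (G t)"
      using pos[OF t] sub[OF t] by (intro mult_left_mono)
    moreover have "(norm (G t))\<^sup>2 / 2 * (\<gamma> t)\<^sup>2 \<le> M\<^sup>2 / 2 * (\<gamma> t)\<^sup>2"
      using bound[OF t] by (intro mult_right_mono divide_right_mono power_mono) auto
    ultimately show ?thesis
      by linarith
  qed
  have "(\<Sum>t=1..T. \<gamma> t * (l t (x t) - l t y))
      \<le> (\<Sum>t=1..T. ((norm (x t - y))\<^sup>2 / 2 - (norm (x (t + 1) - y))\<^sup>2 / 2) + M\<^sup>2 / 2 * (\<gamma> t)\<^sup>2)"
    by (intro sum_mono one)
  also have "\<dots> = (norm (x 1 - y))\<^sup>2 / 2 - (norm (x (T + 1) - y))\<^sup>2 / 2 + M\<^sup>2 / 2 * (\<Sum>t=1..T. (\<gamma> t)\<^sup>2)"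
  proof -
    have "(\<Sum>t=1..n. a t - a (t + 1)) = a 1 - a (n + 1)" for a :: "nat \<Rightarrow> real" and n
      by (induction n) auto
    from this[of "\<lambda>t. (norm (x t - y))\<^sup>2 / 2" T] show ?thesis
      unfolding sum.distrib sum_distrib_left by simp
  qed
  finally show ?thesis
    using zero_le_power2[of "norm (x (T + 1) - y)"] by linarith
qed

section \<open>The averaged gap along a run\<close>

text \<open>A sequence that contracts up to perturbations \<open>d\<close>: summing the recursion and dropping
  \<open>P (T + 1) \<ge> 0\<close> bounds the whole sum at once.\<close>

lemma sum_contraction_le:
  fixes P d :: "nat \<Rightarrow> real"
  assumes "\<And>t. t \<in> {1..T} \<Longrightarrow> P (t + 1) \<le> q * P t + d t"
    and "\<And>t. 0 \<le> P t"
  shows "(1 - q) * (\<Sum>t=1..T. P t) \<le> P 1 + (\<Sum>t=1..T. d t)"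
proof -
  have "(\<Sum>t=1..n. P t) + P (n + 1) \<le> P 1 + q * (\<Sum>t=1..n. P t) + (\<Sum>t=1..n. d t)"
    if "n \<le> T" for n
    using that
  proof (induction n)
    case (Suc n)
    then show ?case
      using assms(1)[of "Suc n"] by (simp add: algebra_simps)
  qed simp
  from this[of T] show ?thesis
    using assms(2)[of "T + 1"] by (simp add: algebra_simps)
qed

lemma grg_runD:
  assumes "grg_run V X f k T \<gamma> x S"
  shows "x 1 = 0" "S 1 = {}"
    and "t \<in> {1..T} \<Longrightarrow> x (t + 1) = closest_point X (x t - \<gamma> t *\<^sub>R grad f (x t) (S t))"
    and "t \<in> {1..T} \<Longrightarrow> rep_greedy V f k (x (t + 1)) (S t) (S (t + 1))"
  using assms unfolding grg_run_def by blast+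

text \<open>The problem data, with the radius \<open>R\<close> of a ball around the starting point \<open>0\<close> that contains
  \<open>X\<close>. Projections are expressed through \<open>closest_point X\<close>, for which \<open>X\<close> has to be closed and
  nonempty.\<close>

locale convex_submodular_minimax =
  fixes V :: "'v set" and k :: nat and X :: "'a::euclidean_space set"
    and f :: "'a \<Rightarrow> 'v set \<Rightarrow> real" and M R :: real
  assumes finite_V: "finite V" and k_pos: "0 < k"
    and convex_X: "convex X" and closed_X: "closed X" and X_nonempty: "X \<noteq> {}"
    and norm_le_R: "\<And>y. y \<in> X \<Longrightarrow> norm y \<le> R"
    and nonneg: "\<And>x S. S \<subseteq> V \<Longrightarrow> 0 \<le> f x S"
    and convex_f: "\<And>S. S \<subseteq> V \<Longrightarrow> convex_on UNIV (\<lambda>x. f x S)"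
    and differentiable_f: "\<And>x S. S \<subseteq> V \<Longrightarrow> (\<lambda>y. f y S) differentiable (at x)"
    and monotone_f: "\<And>x. mono_on (Pow V) (f x)"
    and submodular_f: "\<And>x. submodular_on V (f x)"
    and bounded_grad: "\<And>x S. S \<subseteq> V \<Longrightarrow> norm (grad f x S) \<le> M"
begin

abbreviation F :: "'a \<Rightarrow> real" where
  "F \<equiv> max_value V k f"

lemma M_nonneg: "0 \<le> M"
  using order_trans[OF norm_ge_zero bounded_grad[of "{}"]] by simp

lemma R_nonneg: "0 \<le> R"
  using X_nonempty norm_le_R order_trans[OF norm_ge_zero] by blast

lemma F_nonneg: "0 \<le> F x"
  using max_value_ge[OF finite_V, of "{}" k f x] nonneg[of "{}" x] by simp

lemma f_lipschitz: "S \<subseteq> V \<Longrightarrow> f x S - f y S \<le> M * norm (x - y)"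
  by (intro convex_on_bounded_grad_lipschitz convex_f differentiable_f bounded_grad)

lemma F_lipschitz: "F x - F y \<le> M * norm (x - y)"
  by (intro max_value_lipschitz finite_V f_lipschitz)

lemma run_feasible:
  assumes "grg_run V X f k T \<gamma> x S" "t \<in> {1..T}"
  shows "S t \<subseteq> V" "card (S t) \<le> k"
proof -
  have "t \<in> {1..T} \<Longrightarrow> S t \<subseteq> V \<and> card (S t) \<le> k" for t
  proof (induction t)
    case (Suc t)
    show ?case
    proof (cases "t = 0")
      case True
      then show ?thesis
        using assms(1) by (simp add: grg_run_def)
    next
      case False
      then have "t \<in> {1..T}"
        using Suc.prems by auto
      then have rep: "rep_greedy V f k (x (t + 1)) (S t) (S (t + 1))" and S: "S t \<subseteq> V" "card (S t) \<le> k"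
        using grg_runD(4)[OF assms(1)] Suc.IH by blast+
      show ?thesis
        using rep_greedy_feasible[OF finite_V rep S k_pos] by simp
    qed
  qed simp
  then show "S t \<subseteq> V" "card (S t) \<le> k"
    using assms(2) by auto
qed

text \<open>The summand \<open>R\<close> accounts for the first step, whose starting point \<open>0\<close> need not lie in \<open>X\<close>.\<close>

lemma run_path_length:
  assumes run: "grg_run V X f k T (\<lambda>_. \<gamma>) x S" and "0 \<le> \<gamma>"
  shows "(\<Sum>t=1..T. norm (x (t + 1) - x t)) \<le> R + real T * (\<gamma> * M)"
proof -
  have step: "x (t + 1) = closest_point X (x t - \<gamma> *\<^sub>R grad f (x t) (S t))" if "t \<in> {1..T}" for t
    by (rule grg_runD(3)[OF run that])
  have inX: "x (t + 1) \<in> X" if "t \<in> {1..T}" for t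
    using step[OF that] closest_point_in_set[OF closed_X X_nonempty] by simp
  have move: "norm (x (t + 1) - x t) \<le> (if t = 1 then R else 0) + \<gamma> * M" if t: "t \<in> {1..T}" for t
  proof (cases "t = 1")
    case True
    have "norm (x (t + 1) - x t) \<le> R"
      using grg_runD(1)[OF run] norm_le_R[OF inX[OF t]] True by simp
    then show ?thesis
      using True \<open>0 \<le> \<gamma>\<close> M_nonneg by (simp add: add_increasing2)
  next
    case False
    then have "t - 1 \<in> {1..T}" "t - 1 + 1 = t"
      using t by auto
    then have "x t \<in> X"
      using inX[of "t - 1"] by metis
    then have "norm (x (t + 1) - x t) \<le> norm (x t - \<gamma> *\<^sub>R grad f (x t) (S t) - x t)"
      unfolding step[OF t]
      using closest_point_lipschitz[OF convex_X closed_X X_nonempty,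
          of "x t - \<gamma> *\<^sub>R grad f (x t) (S t)" "x t"]
      by (simp add: dist_norm closest_point_self)
    also have "\<dots> = \<gamma> * norm (grad f (x t) (S t))"
      using \<open>0 \<le> \<gamma>\<close> by simp
    also have "\<dots> \<le> \<gamma> * M"
      using \<open>0 \<le> \<gamma>\<close> bounded_grad[OF run_feasible(1)[OF run t]] by (rule mult_left_mono[rotated])
    finally show ?thesis
      using False by simp
  qed
  have "(\<Sum>t=1..T. norm (x (t + 1) - x t)) \<le> (\<Sum>t=1..T. (if t = 1 then R else 0) + \<gamma> * M)"
    by (intro sum_mono move)
  also have "\<dots> \<le> R + real T * (\<gamma> * M)"
    using R_nonneg by (simp add: sum.distrib)
  finally show ?thesis .
qed

lemma run_gap_sum:
  assumes run: "grg_run V X f k T (\<lambda>_. \<gamma>) x S" and "0 \<le> \<gamma>" and "0 < T"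
  shows "(\<Sum>t=1..T. F (x t) / 2 - f (x t) (S t))
    \<le> real k * (F 0 / 2 + 3 / 2 * M * (R + real T * (\<gamma> * M)))"
proof -
  define P where "P t = max 0 (F (x t) / 2 - f (x t) (S t))" for t
  define d where "d t = 3 / 2 * M * norm (x (t + 1) - x t)" for t
  define q where "q = 1 - 1 / real k"
  have q: "0 \<le> q" "q \<le> 1"
    using k_pos by (auto simp: q_def)
  have d_nonneg: "0 \<le> d t" for t
    using M_nonneg by (simp add: d_def)
  have contraction: "P (t + 1) \<le> q * P t + d t" if t: "t \<in> {1..T}" for t
  proof -
    have S: "S t \<subseteq> V"
      by (rule run_feasible(1)[OF run t])
    have rep: "rep_greedy V f k (x (t + 1)) (S t) (S (t + 1))"
      by (rule grg_runD(4)[OF run t])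
    have "F (x (t + 1)) / 2 - f (x (t + 1)) (S (t + 1))
        \<le> q * max 0 (F (x (t + 1)) / 2 - f (x (t + 1)) (S t))"
      unfolding q_def
      by (rule rep_greedy_gap[OF finite_V submodular_f monotone_f nonneg S k_pos rep])
    also have "\<dots> \<le> q * (P t + d t)"
    proof (intro mult_left_mono q)
      have "F (x (t + 1)) / 2 - f (x (t + 1)) (S t) \<le> F (x t) / 2 - f (x t) (S t) + d t"
        using F_lipschitz[of "x (t + 1)" "x t"] f_lipschitz[OF S, of "x t" "x (t + 1)"]
        by (simp add: d_def norm_minus_commute)
      then show "max 0 (F (x (t + 1)) / 2 - f (x (t + 1)) (S t)) \<le> P t + d t"
        using d_nonneg[of t] by (simp add: P_def)
    qed
    also have "\<dots> \<le> q * P t + d t"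
      using q d_nonneg[of t] by (simp add: distrib_left mult_left_le_one_le)
    finally show ?thesis
      using q d_nonneg[of t] by (simp add: P_def)
  qed
  have "(1 - q) * (\<Sum>t=1..T. P t) \<le> P 1 + (\<Sum>t=1..T. d t)"
    by (rule sum_contraction_le[where P = P and q = q and d = d, OF contraction]) (simp_all add: P_def)
  also have "P 1 \<le> F 0 / 2"
    using grg_runD(1,2)[OF run] nonneg[of "{}" 0] F_nonneg[of 0] by (simp add: P_def max_def)
  also have "(\<Sum>t=1..T. d t) \<le> 3 / 2 * M * (R + real T * (\<gamma> * M))"
    unfolding d_def sum_distrib_left[symmetric]
    using M_nonneg run_path_length[OF run \<open>0 \<le> \<gamma>\<close>] by (intro mult_left_mono) auto
  finally have "(\<Sum>t=1..T. P t) \<le> real k * (F 0 / 2 + 3 / 2 * M * (R + real T * (\<gamma> * M)))"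
    using k_pos by (simp add: q_def field_simps)
  moreover have "(\<Sum>t=1..T. F (x t) / 2 - f (x t) (S t)) \<le> (\<Sum>t=1..T. P t)"
    by (intro sum_mono) (simp add: P_def)
  ultimately show ?thesis
    by linarith
qed

lemma run_value_sum:
  assumes run: "grg_run V X f k T (\<lambda>_. \<gamma>) x S" and "0 < \<gamma>" and "y \<in> X"
  shows "(\<Sum>t=1..T. f (x t) (S t)) \<le> real T * F y + R\<^sup>2 / (2 * \<gamma>) + M\<^sup>2 / 2 * (real T * \<gamma>)"
proof -
  have "(\<Sum>t=1..T. \<gamma> * (f (x t) (S t) - f y (S t)))
      \<le> (norm (x 1 - y))\<^sup>2 / 2 + M\<^sup>2 / 2 * (\<Sum>t=1..T. \<gamma>\<^sup>2)"
  proof (rule projected_gradient_regret[OF convex_X closed_X \<open>y \<in> X\<close>,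
        where l = "\<lambda>t x. f x (S t)" and G = "\<lambda>t. grad f (x t) (S t)"])
    fix t assume t: "t \<in> {1..T}"
    note S = run_feasible(1)[OF run t]
    show "x (t + 1) = closest_point X (x t - \<gamma> *\<^sub>R grad f (x t) (S t))"
      by (rule grg_runD(3)[OF run t])
    show "f (x t) (S t) - f y (S t) \<le> inner (x t - y) (grad f (x t) (S t))"
      by (intro convex_on_grad_ineq convex_f differentiable_f S)
    show "norm (grad f (x t) (S t)) \<le> M"
      by (rule bounded_grad[OF S])
    show "0 \<le> \<gamma>"
      using \<open>0 < \<gamma>\<close> by simp
  qed
  also have "(norm (x 1 - y))\<^sup>2 \<le> R\<^sup>2"
    using run norm_le_R[OF \<open>y \<in> X\<close>] by (intro power_mono) (auto simp: grg_run_def)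
  finally have "\<gamma> * (\<Sum>t=1..T. f (x t) (S t) - f y (S t)) \<le> R\<^sup>2 / 2 + M\<^sup>2 / 2 * (real T * \<gamma>\<^sup>2)"
    by (simp add: sum_distrib_left)
  then have "(\<Sum>t=1..T. f (x t) (S t) - f y (S t)) \<le> R\<^sup>2 / (2 * \<gamma>) + M\<^sup>2 / 2 * (real T * \<gamma>)"
    using \<open>0 < \<gamma>\<close> by (simp add: field_simps power2_eq_square)
  moreover have "(\<Sum>t=1..T. f y (S t)) \<le> (\<Sum>t=1..T. F y)"
    by (intro sum_mono max_value_ge finite_V run_feasible[OF run])
  ultimately show ?thesis
    by (simp add: sum_subtractf)
qed

lemma F_grg_output_le:
  assumes "0 < \<gamma>" "0 < T"
  shows "real T * F (grg_output T (\<lambda>_. \<gamma>) x) \<le> (\<Sum>t=1..T. F (x t))"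
proof -
  have "grg_output T (\<lambda>_. \<gamma>) x = (\<Sum>t=1..T. (1 / real T) *\<^sub>R x t)"
    using assms by (simp add: grg_output_def scaleR_sum_right[symmetric] field_simps)
  moreover have "F (\<Sum>t=1..T. (1 / real T) *\<^sub>R x t) \<le> (\<Sum>t=1..T. (1 / real T) * F (x t))"
    using assms(2)
    by (intro convex_on_sum[where C = UNIV] convex_on_max_value finite_V convex_f) auto
  ultimately show ?thesis
    using assms(2) by (simp add: sum_divide_distrib[symmetric] field_simps)
qed

lemma grg_output_value_le:
  assumes run: "grg_run V X f k T (\<lambda>_. \<gamma>) x S" and "0 < \<gamma>" "0 < T" "y \<in> X"
  shows "F (grg_output T (\<lambda>_. \<gamma>) x) / 2 \<le> F y + real k * (F 0 / 2 + 3 / 2 * M * R) / real T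
    + R\<^sup>2 / (2 * \<gamma> * real T) + (3 / 2 * real k + 1 / 2) * M\<^sup>2 * \<gamma>"
proof -
  have "real T * (F (grg_output T (\<lambda>_. \<gamma>) x) / 2)
      \<le> (\<Sum>t=1..T. F (x t) / 2 - f (x t) (S t)) + (\<Sum>t=1..T. f (x t) (S t))"
    using F_grg_output_le[OF assms(2,3), of x] by (simp add: sum_subtractf sum_divide_distrib[symmetric])
  also have "\<dots> \<le> real k * (F 0 / 2 + 3 / 2 * M * (R + real T * (\<gamma> * M)))
      + (real T * F y + R\<^sup>2 / (2 * \<gamma>) + M\<^sup>2 / 2 * (real T * \<gamma>))"
    using assms by (intro add_mono run_gap_sum[OF run] run_value_sum[OF run]) auto
  also have "\<dots> = real T * (F y + real k * (F 0 / 2 + 3 / 2 * M * R) / real T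
    + R\<^sup>2 / (2 * \<gamma> * real T) + (3 / 2 * real k + 1 / 2) * M\<^sup>2 * \<gamma>)"
    using assms(2,3) by (simp add: field_simps power2_eq_square)
  finally show ?thesis
    using assms(3) by simp
qed

end

section \<open>Choice of step size and number of iterations\<close>

text \<open>The three error terms \<open>a / T\<close>, \<open>b / (\<gamma> T)\<close> and \<open>c \<gamma>\<close> are balanced by \<open>\<gamma> \<approx> \<epsilon>\<close> and
  \<open>T \<approx> 1 / \<epsilon>\<^sup>2\<close>.\<close>

lemma balance_error_terms:
  fixes a b c :: real
  assumes "0 \<le> a" "0 \<le> b" "0 \<le> c"
  obtains C1 C2 :: real where
    "\<And>\<epsilon>. 0 < \<epsilon> \<Longrightarrow> \<epsilon> < 1 \<Longrightarrow>
       \<exists>(T::nat) \<gamma>. 0 < T \<and> real T \<le> C1 / \<epsilon>\<^sup>2 \<and> 0 < \<gamma> \<and> \<gamma> \<le> C2 * \<epsilon> \<and>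
         a / real T + b / (\<gamma> * real T) + c * \<gamma> \<le> \<epsilon>"
proof -
  \<comment> \<open>\<open>C\<close> is the step size per \<open>\<epsilon>\<close> and makes \<open>c \<gamma> \<le> \<epsilon> / 2\<close>; with \<open>T \<ge> D / \<epsilon>\<^sup>2\<close> the other two terms sum
    to at most \<open>\<epsilon> / 2\<close>. The factor \<open>2\<close> in the bound \<open>T \<le> 2 D / \<epsilon>\<^sup>2\<close> absorbs the rounding up to an integer.\<close>
  define C where "C = 1 / (2 * (c + 1))"
  define E where "E = a + b / C"
  define D where "D = 2 * E + 1"
  have C: "0 < C" "c * C \<le> 1 / 2"
    using assms(3) by (auto simp: C_def field_simps)
  have D: "1 \<le> D"
    using assms C by (simp add: D_def E_def)
  have "\<exists>(T::nat) \<gamma>. 0 < T \<and> real T \<le> 2 * D / \<epsilon>\<^sup>2 \<and> 0 < \<gamma> \<and> \<gamma> \<le> C * \<epsilon> \<and>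
         a / real T + b / (\<gamma> * real T) + c * \<gamma> \<le> \<epsilon>" if \<epsilon>: "0 < \<epsilon>" "\<epsilon> < 1" for \<epsilon>
  proof (intro exI conjI)
    let ?T = "nat \<lceil>D / \<epsilon>\<^sup>2\<rceil>" and ?\<gamma> = "C * \<epsilon>"
    have "\<epsilon>\<^sup>2 \<le> D"
      using \<epsilon> D power_le_one[of \<epsilon> 2] by simp
    then have "1 \<le> D / \<epsilon>\<^sup>2"
      using \<epsilon> by simp
    then have T: "D / \<epsilon>\<^sup>2 \<le> real ?T" "real ?T \<le> D / \<epsilon>\<^sup>2 + 1" "0 < ?T"
      by linarith+
    show "0 < ?T" "?\<gamma> \<le> C * \<epsilon>" "0 < ?\<gamma>"
      using T C \<epsilon> by auto
    show "real ?T \<le> 2 * D / \<epsilon>\<^sup>2"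
      using T(2) \<open>1 \<le> D / \<epsilon>\<^sup>2\<close> unfolding mult_2 add_divide_distrib by linarith
    have "a + b / ?\<gamma> \<le> E / \<epsilon>"
      using \<epsilon> assms(1) C by (simp add: E_def field_simps mult_left_le_one_le)
    also have "\<dots> \<le> (D / 2) / \<epsilon>"
      using \<epsilon> by (intro divide_right_mono) (auto simp: D_def)
    also have "\<dots> = (\<epsilon> / 2) * (D / \<epsilon>\<^sup>2)"
      using \<epsilon> by (simp add: power2_eq_square)
    also have "\<dots> \<le> (\<epsilon> / 2) * real ?T"
      using T(1) \<epsilon> by (intro mult_left_mono) auto
    finally have 1: "(a + b / ?\<gamma>) / real ?T \<le> \<epsilon> / 2"
      using T(3) by (simp add: divide_le_eq)
    have 2: "c * ?\<gamma> \<le> \<epsilon> / 2"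
      using mult_right_mono[OF C(2), of \<epsilon>] \<epsilon> by simp
    have "a / real ?T + b / (?\<gamma> * real ?T) + c * ?\<gamma> = (a + b / ?\<gamma>) / real ?T + c * ?\<gamma>"
      by (simp add: add_divide_distrib)
    also have "\<dots> \<le> \<epsilon> / 2 + \<epsilon> / 2"
      by (intro add_mono 1 2)
    finally show "a / real ?T + b / (?\<gamma> * real ?T) + c * ?\<gamma> \<le> \<epsilon>"
      by simp
  qed
  then show thesis
    using that by blast
qed

theorem theorem5:
  fixes V :: "'v set" and k :: nat
    and X :: "(real ^ 'd) set"
    and f :: "real ^ 'd \<Rightarrow> 'v set \<Rightarrow> real"
    and L M :: real
  assumes "finite V" and "0 < k" and "k \<le> card V"
    and "convex X" and "bounded X" and "projection_well_defined X"
    and nonneg: "\<And>x S. S \<subseteq> V \<Longrightarrow> 0 \<le> f x S"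
    and convex_f: "\<And>S. S \<subseteq> V \<Longrightarrow> convex_on UNIV (\<lambda>x. f x S)"
    and differentiable_f: "\<And>x S. S \<subseteq> V \<Longrightarrow> (\<lambda>y. f y S) differentiable (at x)"
    and monotone_f: "\<And>x. mono_on (Pow V) (f x)"
    and submodular_f: "\<And>x. submodular_on V (f x)"
    and smooth: "\<And>x x' S. S \<subseteq> V \<Longrightarrow> card S \<le> k \<Longrightarrow>
                   norm (grad f x S - grad f x' S) \<le> L * norm (x - x')"
    and bounded_grad: "\<And>x S. S \<subseteq> V \<Longrightarrow> norm (grad f x S) \<le> M"
  shows "\<exists>C1 C2 \<epsilon>0 :: real. 0 < \<epsilon>0 \<and>
           (\<forall>\<epsilon>. 0 < \<epsilon> \<and> \<epsilon> < \<epsilon>0 \<longrightarrow>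
             (\<exists>(T::nat) \<gamma> :: nat \<Rightarrow> real.
                0 < T \<and> real T \<le> C1 / \<epsilon>\<^sup>2 \<and>
                (\<forall>t\<in>{1..T}. 0 < \<gamma> t \<and> \<gamma> t \<le> C2 * \<epsilon>) \<and>
                (\<forall>x S. grg_run V X f k T \<gamma> x S \<longrightarrow>
                   approx_minimax_solution V X k f (1/2) \<epsilon> (grg_output T \<gamma> x))))"
proof -
  have X: "closed X" "X \<noteq> {}"
    using projection_well_defined_imp_closed assms(6) by blast+
  obtain R where R: "\<And>y. y \<in> X \<Longrightarrow> norm y \<le> R"
    using \<open>bounded X\<close> unfolding bounded_iff by blast
  interpret convex_submodular_minimax V k X f M R
    by unfold_locales (use assms X R in auto)
  let ?a = "real k * (F 0 / 2 + 3 / 2 * M * R)" and ?b = "R\<^sup>2 / 2"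
    and ?c = "(3 / 2 * real k + 1 / 2) * M\<^sup>2"
  obtain C1 C2 where C: "\<And>\<epsilon>. 0 < \<epsilon> \<Longrightarrow> \<epsilon> < 1 \<Longrightarrow>
       \<exists>(T::nat) \<gamma>. 0 < T \<and> real T \<le> C1 / \<epsilon>\<^sup>2 \<and> 0 < \<gamma> \<and> \<gamma> \<le> C2 * \<epsilon> \<and>
         ?a / real T + ?b / (\<gamma> * real T) + ?c * \<gamma> \<le> \<epsilon>"
    by (rule balance_error_terms[of ?a ?b ?c]) (use F_nonneg[of 0] M_nonneg R_nonneg in auto)
  show ?thesis
  proof (rule exI[of _ C1], rule exI[of _ C2], rule exI[of _ "1::real"], intro conjI allI impI)
    fix \<epsilon> :: real assume "0 < \<epsilon> \<and> \<epsilon> < 1"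
    then obtain T :: nat and \<gamma> where T: "0 < T" "real T \<le> C1 / \<epsilon>\<^sup>2" and \<gamma>: "0 < \<gamma>" "\<gamma> \<le> C2 * \<epsilon>"
      and err: "?a / real T + ?b / (\<gamma> * real T) + ?c * \<gamma> \<le> \<epsilon>"
      using C by blast
    have "approx_minimax_solution V X k f (1/2) \<epsilon> (grg_output T (\<lambda>_. \<gamma>) x)"
      if run: "grg_run V X f k T (\<lambda>_. \<gamma>) x S" for x S
    proof -
      have "F (grg_output T (\<lambda>_. \<gamma>) x) / 2 - \<epsilon> \<le> F y" if "y \<in> X" for y
      proof -
        have "R\<^sup>2 / (2 * \<gamma> * real T) = R\<^sup>2 / 2 / (\<gamma> * real T)"
          by simp
        then show ?thesis
          using grg_output_value_le[OF run \<gamma>(1) T(1) that] err by linarith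
      qed
      then have "F (grg_output T (\<lambda>_. \<gamma>) x) / 2 - \<epsilon> \<le> (INF y\<in>X. F y)"
        using X(2) by (intro cINF_greatest)
      then show ?thesis
        by (simp add: approx_minimax_solution_def)
    qed
    then show "\<exists>(T::nat) \<gamma> :: nat \<Rightarrow> real.
                0 < T \<and> real T \<le> C1 / \<epsilon>\<^sup>2 \<and>
                (\<forall>t\<in>{1..T}. 0 < \<gamma> t \<and> \<gamma> t \<le> C2 * \<epsilon>) \<and>
                (\<forall>x S. grg_run V X f k T \<gamma> x S \<longrightarrow>
                   approx_minimax_solution V X k f (1/2) \<epsilon> (grg_output T \<gamma> x))"
      using T \<gamma> by (intro exI[of _ T] exI[of _ "\<lambda>_. \<gamma>"]) auto
  qed simp
qed

end
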